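(* Let $\kappa$ be a regular uncountable cardinal, $\lambda \geq \kappa$ a cardinal, and $\tau \leq \kappa$ an infinite cardinal. (i) Suppose that $\lambda$ is regular and $PS^+(\tau, \kappa, \lambda)$ holds. Then $PS^+(\tau, \lambda)$ holds. (ii) Suppose that $\mathrm{cf}(\lambda) < \kappa$ and $PS^+((\mathrm{cf}(\lambda))^+, \kappa, \lambda)$ holds. Then $PS^+((\mathrm{cf}(\lambda))^+, \lambda^+)$ holds.
   Context: $P_\kappa(\lambda) = \{a \subseteq \lambda : |a| < \kappa\}$, and $I_{\kappa,\lambda}^+$ is the collection of all $B \subseteq P_\kappa(\lambda)$ that are cofinal in $(P_\kappa(\lambda), \subseteq)$. A partition of a set $X$ is a set of pairwise disjoint nonempty subsets of $X$ with union $X$. Three-argument version: for an infinite cardinal $\tau \leq \kappa$, $PS^+(\tau,\kappa,\lambda)$ means: given, for each $a \in P_\kappa(\lambda)$, a partition $Q_a$ of $P_\kappa(\lambda)$ with $|Q_a| < \tau$, there are $B \in I_{\kappa,\lambda}^+$ and $h \in \prod_{a \in P_\kappa(\lambda)} Q_a$ such that for any $a, b \in B$, the set $\{c \in h(a) \cap h(b) : a \cup b \subseteq c\}$ is nonempty. Two-argument version: for a regular uncountable cardinal $\mu$ and an infinite cardinal $\tau$, $PS^+(\tau,\mu)$ means: given, for each $\beta \in \mu$, a partition $Q_\beta$ of $\mu \setminus \beta$ with $|Q_\beta| < \tau$, there are a cofinal subset $B$ of $\mu$ and $h \in \prod_{\beta \in B} Q_\beta$ such that $h(\alpha) \cap h(\beta)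 \neq \emptyset$ for any $\alpha, \beta \in B$. *)

theory Defs
  imports Main "HOL-Library.FuncSet" "HOL-Library.Disjoint_Sets"
begin

unbundle cardinal_syntax

text \<open>A cardinal is represented by a relation \<open>r\<close> with \<open>Card_order r\<close>, which well-orders its field in
  the least order type of that cardinality; \<open>Field r\<close> plays the role of the initial ordinal as a set
  of smaller ordinals. Distinct cardinals may live on distinct types.\<close>

text \<open>The library's \<open>cofinal A r\<close> asks for strictly larger elements of \<open>A\<close>. On an infinite cardinal,
  which has no largest element, this is the usual notion.\<close>

definition cofinal_cards :: "'a rel \<Rightarrow> 'a rel set" where
  "cofinal_cards r = {|A| |A. A \<subseteq> Field r \<and> cofinal A r}"

definition cf :: "'a rel \<Rightarrow> 'a rel" where
  "cf r = (SOME c. c \<in> cofinal_cards r \<and> (\<forall>d\<in>cofinal_cards r. c \<le>o d))"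

lemma cf_least:
  assumes "Card_order r" and "natLeq \<le>o r"
  shows "cf r \<in> cofinal_cards r" and "d \<in> cofinal_cards r \<Longrightarrow> cf r \<le>o d"
proof -
  have inf: "\<not> finite (Field r)"
    using assms Card_order_iff_ordLeq_card_of infinite_iff_natLeq_ordLeq ordLeq_transitive by blast
  have "cofinal (Field r) r"
    unfolding cofinal_def using infinite_Card_order_limit[OF assms(1) inf] by blast
  then have "cofinal_cards r \<noteq> {}"
    unfolding cofinal_cards_def by blast
  moreover have "\<forall>c\<in>cofinal_cards r. Card_order c"
    unfolding cofinal_cards_def by (auto intro: card_of_Card_order)
  ultimately have "\<exists>c. c \<in> cofinal_cards r \<and> (\<forall>d\<in>cofinal_cards r. c \<le>o d)"
    using exists_minim_Card_order by blast
  from someI_ex[OF this] show "cf r \<in> cofinal_cards r" "d \<in> cofinal_cards r \<Longrightarrow> cf r \<le>o d"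
    unfolding cf_def by blast+
qed

definition P_card :: "'k rel \<Rightarrow> 'a rel \<Rightarrow> 'a set set" where
  "P_card k l = {a. a \<subseteq> Field l \<and> |a| <o k}"

definition I_plus :: "'k rel \<Rightarrow> 'a rel \<Rightarrow> 'a set set set" where
  "I_plus k l = {B. B \<subseteq> P_card k l \<and> (\<forall>a\<in>P_card k l. \<exists>b\<in>B. a \<subseteq> b)}"

definition PS_plus3 :: "'t rel \<Rightarrow> 'k rel \<Rightarrow> 'a rel \<Rightarrow> bool" where
  "PS_plus3 t k l \<longleftrightarrow>
    (\<forall>Q. (\<forall>a\<in>P_card k l. partition_on (P_card k l) (Q a) \<and> |Q a| <o t) \<longrightarrow>
      (\<exists>B\<in>I_plus k l. \<exists>h\<in>Pi\<^sub>E (P_card k l) Q.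
        \<forall>a\<in>B. \<forall>b\<in>B. {c \<in> h a \<inter> h b. a \<union> b \<subseteq> c} \<noteq> {}))"

text \<open>For \<open>\<beta>\<close> in \<open>Field m\<close>, \<open>above m \<beta>\<close> is the set of elements greater than or equal to \<open>\<beta>\<close>. Under
  the identification of an ordinal with the set of its predecessors this is \<open>m - \<beta>\<close>.\<close>

definition PS_plus2 :: "'t rel \<Rightarrow> 'a rel \<Rightarrow> bool" where
  "PS_plus2 t m \<longleftrightarrow>
    (\<forall>Q. (\<forall>\<beta>\<in>Field m. partition_on (above m \<beta>) (Q \<beta>) \<and> |Q \<beta>| <o t) \<longrightarrow>
      (\<exists>B. B \<subseteq> Field m \<and> cofinal B m \<and>
        (\<exists>h\<in>Pi\<^sub>E B Q. \<forall>\<alpha>\<in>B. \<forall>\<beta>\<in>B. h \<alpha> \<inter> h \<beta> \<noteq> {})))"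

end

theory Submission imports Defs begin

text \<open>Let \<open>m\<close> be \<open>l\<close> in the first part and \<open>cardSuc l\<close> in the second. Both parts follow from the
  existence of sets \<open>d g\<close> in \<open>P_card k l\<close>, for \<open>g\<close> in \<open>m\<close>, such that each \<open>c\<close> in \<open>P_card k l\<close> includes
  \<open>d g\<close> only for a bounded set of \<open>g\<close>. The strict supremum \<open>s c\<close> of this bounded set is monotone in \<open>c\<close>
  and unbounded in \<open>m\<close>, and partitions of final segments of \<open>m\<close> can be pulled back along \<open>s\<close>
  (\<open>PS_plus2_if_monotone_unbounded\<close>, \<open>PS_plus2_if_Tukey_map\<close>).

  If \<open>l\<close> is regular, singletons are such sets.

  If \<open>cf l < k\<close>, one needs \<open>cardSuc l\<close> many sets of size less than \<open>k\<close> such that no set of size less than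
  \<open>k\<close> includes cofinally many of them. Counting is not enough, since there may be more than
  \<open>cardSuc l\<close> many subsets of size \<open>cf l\<close> of a set of size less than \<open>k\<close>. The sets used here are graphs
  of functions \<open>f g\<close> on a cofinal subset \<open>K\<close> of \<open>l\<close> of size \<open>cf l\<close>, and what must be shown is that for
  every cofinal \<open>X\<close> there is an \<open>n \<in> K\<close> at which the functions \<open>f x\<close>, \<open>x \<in> X\<close>, take at least \<open>k\<close>
  values (\<open>spread_family\<close>). The construction follows the one by which Shelah obtains scales of length
  \<open>cardSuc l\<close> in pcf theory: the functions increase modulo initial segments of \<open>K\<close>, and \<open>f d\<close> dominates,
  everywhere on \<open>K\<close>, the functions with index in a small club of \<open>d\<close>. Club guessing on
  \<open>cardSuc (cardSuc k)\<close> (\<open>club_guessing\<close>) then finds, for each \<open>X\<close>, an \<open>n\<close> and \<open>k\<close> many elements of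
  \<open>X\<close> along which \<open>f x n\<close> is strictly increasing.\<close>

section \<open>The strict part of a well-order\<close>

abbreviation lt :: "'a rel \<Rightarrow> 'a \<Rightarrow> 'a \<Rightarrow> bool" where
  "lt r x y \<equiv> x \<in> underS r y"

lemma lt_in_Field:
  assumes "lt r x y" shows "x \<in> Field r" "y \<in> Field r"
  using assms unfolding underS_def Field_def by auto

lemma lt_irrefl [simp]: "\<not> lt r x x"
  unfolding underS_def by simp

lemma lt_trans:
  assumes "Well_order r" "lt r x y" "lt r y z" shows "lt r x z"
proof -
  have "trans r" "antisym r"
    using assms(1) wo_rel.TRANS[of r] wo_rel.ANTISYM[of r] unfolding wo_rel_def by auto
  then show ?thesis
    using assms(2,3) unfolding underS_def trans_def antisym_def by blast
qed

lemma lt_linear: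
  assumes "Well_order r" "x \<in> Field r" "y \<in> Field r" shows "lt r x y \<or> x = y \<or> lt r y x"
  using assms wo_rel.TOTALS[of r] unfolding wo_rel_def underS_def by blast

lemma le_iff_not_lt:
  assumes "Well_order r" "x \<in> Field r" "y \<in> Field r" shows "(x, y) \<in> r \<longleftrightarrow> \<not> lt r y x"
proof -
  have "antisym r" and "Refl r"
    using assms(1) wo_rel.ANTISYM[of r] wo_rel.REFL[of r] unfolding wo_rel_def by auto
  then show ?thesis
    using lt_linear[OF assms] assms(2) unfolding underS_def antisym_def refl_on_def by blast
qed

lemma lt_not_lt_trans:
  assumes "Well_order r" "lt r x y" "\<not> lt r z y" "z \<in> Field r" shows "lt r x z"
  using assms lt_linear[OF assms(1), of y z] lt_trans[OF assms(1)] lt_in_Field[OF assms(2)] by blast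

lemma not_lt_lt_trans:
  assumes "Well_order r" "\<not> lt r y x" "lt r y z" "x \<in> Field r" shows "lt r x z"
  using assms lt_linear[OF assms(1), of y x] lt_trans[OF assms(1)] lt_in_Field[OF assms(3)] by blast

lemma wf_lt: "Well_order r \<Longrightarrow> wf {(x, y). lt r x y}"
proof -
  assume "Well_order r"
  then have "wf (r - Id)" using wo_rel.WF unfolding wo_rel_def by blast
  moreover have "{(x, y). lt r x y} = r - Id" unfolding underS_def by auto
  ultimately show ?thesis by simp
qed

lemma exists_lt_least:
  assumes "Well_order r" "P x"
  shows "\<exists>y. P y \<and> (\<forall>z. lt r z y \<longrightarrow> \<not> P z)"
  using wfE_min[OF wf_lt[OF assms(1)], of x "Collect P"] assms(2) by auto

lemma Card_order_Well_order: "Card_order r \<Longrightarrow> Well_order r"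
  by (simp add: card_order_on_well_order_on)

text \<open>Strict upper bounds inside \<open>A\<close> for all subsets of \<open>A\<close> of size less than \<open>k\<close>: for
  \<open>A = underS r d\<close> this says that the cofinality of \<open>d\<close> is at least \<open>k\<close>. The form with subsets,
  rather than with functions from an index set, avoids fixing an index type.\<close>

definition directed :: "'a rel \<Rightarrow> 'a set \<Rightarrow> 'k rel \<Rightarrow> bool" where
  "directed r A k \<longleftrightarrow> (\<forall>D\<subseteq>A. |D| <o k \<longrightarrow> (\<exists>b\<in>A. \<forall>d\<in>D. lt r d b))"

lemma directed_family:
  assumes "directed r A k" "|I| <o k" "\<forall>i\<in>I. g i \<in> A"
  shows "\<exists>b\<in>A. \<forall>i\<in>I. lt r (g i) b"
proof -
  have "|g ` I| <o k" using card_of_image assms(2) ordLeq_ordLess_trans by blast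
  moreover have "g ` I \<subseteq> A" using assms(3) by blast
  ultimately have "\<exists>b\<in>A. \<forall>d\<in>g ` I. lt r d b"
    using assms(1) unfolding directed_def by blast
  then show ?thesis by blast
qed

lemma Field_directed:
  assumes "Card_order r" "regularCard r" "\<not> finite (Field r)" "k \<le>o r"
  shows "directed r (Field r) k"
  unfolding directed_def
proof (intro allI impI)
  fix D assume D: "D \<subseteq> Field r" "|D| <o k"
  then have "\<not> |D| =o r"
    using assms(4) ordLess_ordLeq_trans not_ordLess_ordIso by blast
  then have "\<not> cofinal D r" using assms(2) D(1) unfolding regularCard_def by blast
  then obtain a where a: "a \<in> Field r" "\<forall>b\<in>D. \<not> lt r a b"
    unfolding cofinal_def underS_def by blast
  obtain b where "lt r a b"
    using infinite_Card_order_limit[OF assms(1,3) a(1)] unfolding underS_def by blast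
  then show "\<exists>b\<in>Field r. \<forall>d\<in>D. lt r d b"
    using a not_lt_lt_trans[OF Card_order_Well_order[OF assms(1)]] D(1) lt_in_Field by (metis subsetD)
qed

section \<open>Clubs and continuous maps\<close>

text \<open>\<open>A\<close> will be \<open>Field r\<close> or an initial segment \<open>underS r d\<close>. In the closure clause the least
  element of the order is vacuously a limit, so it belongs to every club. With this convention
  \<open>0\<close> needs no separate treatment, as a continuous map sends it to the least element.\<close>

definition club :: "'a rel \<Rightarrow> 'a set \<Rightarrow> 'a set \<Rightarrow> bool" where
  "club r A C \<longleftrightarrow> C \<subseteq> A \<and> (\<forall>a\<in>A. \<exists>c\<in>C. lt r a c) \<and>
    (\<forall>b\<in>A. (\<forall>a. lt r a b \<longrightarrow> (\<exists>c\<in>C. lt r a c \<and> lt r c b)) \<longrightarrow> b \<in> C)"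

lemma clubD:
  assumes "club r A C"
  shows "C \<subseteq> A" "a \<in> A \<Longrightarrow> \<exists>c\<in>C. lt r a c"
    "b \<in> A \<Longrightarrow> (\<And>a. lt r a b \<Longrightarrow> \<exists>c\<in>C. lt r a c \<and> lt r c b) \<Longrightarrow> b \<in> C"
  using assms unfolding club_def by blast+

text \<open>Take upper bounds alternately: given \<open>g n\<close>, pick the next element after it of each \<open>C i\<close> and let
  \<open>g (n + 1)\<close> lie above all of these. The supremum of the \<open>g n\<close> is a limit of every \<open>C i\<close>.\<close>

lemma club_Inter:
  assumes r: "Well_order r" and A: "A \<subseteq> Field r" "\<forall>a\<in>A. underS r a \<subseteq> A"
    and dir: "directed r A k" and k: "natLeq <o k" and I: "|I| <o k"
    and C: "\<And>i. i \<in> I \<Longrightarrow> club r A (C i)"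
  shows "club r A (A \<inter> (\<Inter>i\<in>I. C i))"
  unfolding club_def
proof (intro conjI ballI impI)
  fix a assume a: "a \<in> A"
  define nx where "nx i x = (SOME c. c \<in> C i \<and> lt r x c)" for i x
  have nx: "nx i x \<in> C i" "lt r x (nx i x)" "nx i x \<in> A" if "i \<in> I" "x \<in> A" for i x
  proof -
    have "\<exists>c. c \<in> C i \<and> lt r x c" using clubD(2)[OF C[OF that(1)] that(2)] by blast
    from someI_ex[OF this] show "nx i x \<in> C i" "lt r x (nx i x)" unfolding nx_def by auto
    then show "nx i x \<in> A" using clubD(1)[OF C[OF that(1)]] by blast
  qed
  have fin1: "|{()}| <o k" using k
    by (meson card_of_nat finite.emptyI finite_insert finite_iff_ordLess_natLeq ordLess_transitive)
  have step: "\<exists>y. y \<in> A \<and> lt r x y \<and> (\<forall>i\<in>I. lt r (nx i x) y)" if x: "x \<in> A" for x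
  proof -
    obtain b where b: "b \<in> A" "\<And>i. i \<in> I \<Longrightarrow> lt r (nx i x) b"
      using directed_family[OF dir I, of "\<lambda>i. nx i x"] nx x by blast
    obtain b' where b': "b' \<in> A" "lt r x b'"
      using directed_family[OF dir fin1, of "\<lambda>_. x"] x by blast
    consider "lt r b b'" | "b = b'" | "lt r b' b" using lt_linear[OF r] b b' A by blast
    then show ?thesis using b b' lt_trans[OF r] by cases blast+
  qed
  define g where "g = rec_nat a (\<lambda>_ x. SOME y. y \<in> A \<and> lt r x y \<and> (\<forall>i\<in>I. lt r (nx i x) y))"
  have gS: "g (Suc n) = (SOME y. y \<in> A \<and> lt r (g n) y \<and> (\<forall>i\<in>I. lt r (nx i (g n)) y))" for n
    unfolding g_def by simp
  have g0: "g 0 = a" unfolding g_def by simp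
  have gA: "g n \<in> A" for n
  proof (induction n)
    case (Suc n) show ?case unfolding gS using someI_ex[OF step[OF Suc]] by blast
  qed (simp add: g0 a)
  have gs: "lt r (g n) (g (Suc n))" "i \<in> I \<Longrightarrow> lt r (nx i (g n)) (g (Suc n))" for n i
    unfolding gS using someI_ex[OF step[OF gA[of n]]] by blast+
  have "|UNIV :: nat set| <o k" using k card_of_nat ordIso_ordLess_trans by blast
  from directed_family[OF dir this, of g] gA obtain b0 where "b0 \<in> A \<and> (\<forall>n. lt r (g n) b0)"
    by blast
  from exists_lt_least[OF r, of "\<lambda>b. b \<in> A \<and> (\<forall>n. lt r (g n) b)", OF this]
  obtain b where b: "b \<in> A" "\<And>n. lt r (g n) b"
    and least: "\<And>z. lt r z b \<Longrightarrow> \<not> (z \<in> A \<and> (\<forall>n. lt r (g n) z))" by blast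
  have "b \<in> C i" if i: "i \<in> I" for i
  proof (rule clubD(3)[OF C[OF i] b(1)])
    fix x assume x: "lt r x b"
    then obtain n where n: "\<not> lt r (g n) x" using least A(2) b(1) by blast
    then have "lt r x (g (Suc n))"
      using not_lt_lt_trans[OF r n gs(1)] lt_in_Field[OF x] by blast
    then have "lt r x (nx i (g (Suc n)))" using lt_trans[OF r] nx(2)[OF i gA] by blast
    moreover have "lt r (nx i (g (Suc n))) b" using lt_trans[OF r gs(2)[OF i] b(2)] by blast
    ultimately show "\<exists>c\<in>C i. lt r x c \<and> lt r c b" using nx(1)[OF i gA] by blast
  qed
  moreover have "lt r a b" using b(2)[of 0] g0 by simp
  ultimately show "\<exists>c\<in>A \<inter> (\<Inter>i\<in>I. C i). lt r a c" using b(1) by blast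
next
  fix b assume b: "b \<in> A"
    and lim: "\<forall>a. lt r a b \<longrightarrow> (\<exists>c\<in>A \<inter> (\<Inter>i\<in>I. C i). lt r a c \<and> lt r c b)"
  have "b \<in> C i" if "i \<in> I" for i
    using clubD(3)[OF C[OF that] b] lim that by blast
  then show "b \<in> A \<inter> (\<Inter>i\<in>I. C i)" using b by blast
qed blast

lemma club_Int:
  assumes r: "Well_order r" and A: "A \<subseteq> Field r" "\<forall>a\<in>A. underS r a \<subseteq> A"
    and dir: "directed r A k" and k: "natLeq <o k" and C: "club r A C" "club r A D"
  shows "club r A (C \<inter> D)"
proof -
  have "|UNIV :: bool set| <o k" using k
    by (meson finite finite_iff_ordLess_natLeq ordLess_transitive)
  then have "club r A (A \<inter> (\<Inter>i\<in>UNIV. if i then C else D))"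
    using C by (intro club_Inter[OF r A dir k]) auto
  moreover have "A \<inter> (\<Inter>i\<in>UNIV. if i then C else D) = C \<inter> D"
    using clubD(1)[OF C(1)] by (auto split: if_splits)
  ultimately show ?thesis by simp
qed

text \<open>Recursion that takes suprema at limits: \<open>e i\<close> is the least upper bound of the values \<open>G e j\<close>,
  \<open>j < i\<close>, where \<open>G e j\<close> lies above \<open>e j\<close> and may depend on \<open>e\<close> up to and including \<open>j\<close>. As \<open>G e j\<close>
  is not above \<open>e j'\<close> for \<open>j' > j\<close>, this covers successor and limit steps at once.\<close>

lemma continuous_recursion:
  fixes p :: "'i rel" and m :: "'m rel" and G :: "('i \<Rightarrow> 'm) \<Rightarrow> 'i \<Rightarrow> 'm"
  assumes p: "Well_order p" and m: "Well_order m"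
    and dir: "\<And>i. i \<in> Field p \<Longrightarrow> |underS p i| <o k" "directed m (Field m) k"
    and adm: "\<And>e e' j. (\<And>i. i = j \<or> lt p i j \<Longrightarrow> e i = e' i) \<Longrightarrow> G e j = G e' j"
    and inc: "\<And>e j. (\<And>i. i = j \<or> lt p i j \<Longrightarrow> e i \<in> Field m) \<Longrightarrow> j \<in> Field p \<Longrightarrow> lt m (e j) (G e j)"
  obtains e where "\<And>i. i \<in> Field p \<Longrightarrow> e i \<in> Field m"
    and "\<And>i j. lt p j i \<Longrightarrow> \<not> lt m (e i) (G e j)"
    and "\<And>i u. i \<in> Field p \<Longrightarrow> lt m u (e i) \<Longrightarrow> \<exists>j. lt p j i \<and> lt m u (G e j)"
proof -
  define ub where "ub e i u \<longleftrightarrow> u \<in> Field m \<and> (\<forall>j. lt p j i \<longrightarrow> \<not> lt m u (G e j))" for e i u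
  define H where "H e i = (SOME u. ub e i u \<and> (\<forall>z. lt m z u \<longrightarrow> \<not> ub e i z))" for e i
  have "adm_wf {(x, y). lt p x y} H"
    unfolding adm_wf_def
  proof (intro allI impI)
    fix e e' :: "'i \<Rightarrow> 'm" and i
    assume eq: "\<forall>z. (z, i) \<in> {(x, y). lt p x y} \<longrightarrow> e z = e' z"
    have "G e j = G e' j" if "lt p j i" for j
      using eq that lt_trans[OF p] by (intro adm) blast
    then have "ub e i = ub e' i" unfolding ub_def by auto
    then show "H e i = H e' i" unfolding H_def by simp
  qed
  then obtain e where e: "e = H e" using wfrec_fixpoint[OF wf_lt[OF p]] by blast
  have main: "i \<in> Field p \<longrightarrow> ub e i (e i) \<and> (\<forall>z. lt m z (e i) \<longrightarrow> \<not> ub e i z)" for i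
  proof (induction i rule: wf_induct_rule[OF wf_lt[OF p]])
    case (1 i)
    show ?case
    proof
      assume i: "i \<in> Field p"
      have IH: "e j \<in> Field m" if "lt p j i" for j
        using 1[of j] that lt_in_Field[OF that] unfolding ub_def by simp
      have "G e j \<in> Field m" if "lt p j i" for j
      proof (rule lt_in_Field(2)[OF inc])
        show "j \<in> Field p" using lt_in_Field[OF that] by simp
        fix x assume "x = j \<or> lt p x j"
        then show "e x \<in> Field m" using IH that lt_trans[OF p] by blast
      qed
      then obtain b where b: "b \<in> Field m" "\<And>j. j \<in> underS p i \<Longrightarrow> lt m (G e j) b"
        using directed_family[OF dir(2) dir(1)[OF i], of "G e"] by blast
      then have "ub e i b" unfolding ub_def using lt_trans[OF m] lt_irrefl by metis
      then obtain y where "ub e i y \<and> (\<forall>z. lt m z y \<longrightarrow> \<not> ub e i z)"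
        using exists_lt_least[OF m, of "ub e i"] by blast
      from someI[of "\<lambda>u. ub e i u \<and> (\<forall>z. lt m z u \<longrightarrow> \<not> ub e i z)", OF this]
      show "ub e i (e i) \<and> (\<forall>z. lt m z (e i) \<longrightarrow> \<not> ub e i z)"
        unfolding H_def[symmetric] e[symmetric] using e by metis
    qed
  qed
  show thesis
  proof
    show "e i \<in> Field m" if "i \<in> Field p" for i using main that unfolding ub_def by blast
    show "\<not> lt m (e i) (G e j)" if "lt p j i" for i j
      using main[of i] that lt_in_Field[OF that] unfolding ub_def by blast
    show "\<exists>j. lt p j i \<and> lt m u (G e j)" if "i \<in> Field p" "lt m u (e i)" for i u
      using main[of i] that lt_in_Field[OF that(2)] unfolding ub_def by blast
  qed
qed

text \<open>A strictly increasing continuous map onto a cofinal subset of \<open>d\<close>. A limit \<open>i\<close> is expressed as an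
  index below which there is no largest one.\<close>

definition normal_map :: "'i rel \<Rightarrow> 'm rel \<Rightarrow> ('i \<Rightarrow> 'm) \<Rightarrow> 'm \<Rightarrow> bool" where
  "normal_map p m e d \<longleftrightarrow> (\<forall>i\<in>Field p. lt m (e i) d) \<and> (\<forall>i j. lt p i j \<longrightarrow> lt m (e i) (e j)) \<and>
    (\<forall>x. lt m x d \<longrightarrow> (\<exists>i\<in>Field p. lt m x (e i))) \<and>
    (\<forall>i\<in>Field p. (\<forall>j. lt p j i \<longrightarrow> (\<exists>j'. lt p j j' \<and> lt p j' i)) \<longrightarrow>
      (\<forall>x. lt m x (e i) \<longrightarrow> (\<exists>j. lt p j i \<and> lt m x (e j))))"

lemma normal_mapI:
  assumes p: "Well_order p" and m: "Well_order m" and nomax: "\<And>i. i \<in> Field p \<Longrightarrow> \<exists>j. lt p i j"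
    and dir: "|Field p| <o k" "directed m (Field m) k"
    and e: "\<And>i. i \<in> Field p \<Longrightarrow> e i \<in> Field m"
    and inc: "\<And>i. i \<in> Field p \<Longrightarrow> lt m (e i) (G i)"
    and up: "\<And>i j. lt p j i \<Longrightarrow> \<not> lt m (e i) (G j)"
    and least: "\<And>i u. i \<in> Field p \<Longrightarrow> lt m u (e i) \<Longrightarrow> \<exists>j. lt p j i \<and> lt m u (G j)"
  obtains d where "normal_map p m e d"
proof -
  obtain b where b: "b \<in> Field m" "\<And>i. i \<in> Field p \<Longrightarrow> lt m (e i) b"
    using directed_family[OF dir(2,1), of e] e by blast
  from exists_lt_least[OF m, of "\<lambda>b. \<forall>i\<in>Field p. lt m (e i) b" b] b(2)
  obtain d where d: "\<And>i. i \<in> Field p \<Longrightarrow> lt m (e i) d"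
    and dl: "\<And>z. lt m z d \<Longrightarrow> \<not> (\<forall>i\<in>Field p. lt m (e i) z)" by blast
  have mono: "lt m (e i) (e j)" if "lt p i j" for i j
    using lt_not_lt_trans[OF m inc[OF lt_in_Field(1)[OF that]] up[OF that]
        e[OF lt_in_Field(2)[OF that]]] .
  have cof: "\<exists>i\<in>Field p. lt m x (e i)" if x: "lt m x d" for x
  proof -
    obtain i where i: "i \<in> Field p" "\<not> lt m (e i) x" using dl[OF x] by blast
    obtain j where j: "lt p i j" using nomax i by blast
    show ?thesis
      using not_lt_lt_trans[OF m i(2) mono[OF j] lt_in_Field(1)[OF x]] lt_in_Field(2)[OF j] by blast
  qed
  have "\<exists>j. lt p j i \<and> lt m x (e j)"
    if i: "i \<in> Field p" "\<And>j. lt p j i \<Longrightarrow> \<exists>j'. lt p j j' \<and> lt p j' i" "lt m x (e i)" for i x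
  proof -
    obtain j where j: "lt p j i" "lt m x (G j)" using least[OF i(1,3)] by blast
    obtain j' where j': "lt p j j'" "lt p j' i" using i(2)[OF j(1)] by blast
    have "lt m x (e j')"
      using lt_not_lt_trans[OF m j(2) up[OF j'(1)] e[OF lt_in_Field(2)[OF j'(1)]]] .
    then show ?thesis using j' by blast
  qed
  then have "normal_map p m e d" unfolding normal_map_def using d mono cof by blast
  then show thesis by (rule that)
qed

text \<open>If \<open>b\<close> is a limit of values and \<open>i\<close> is the first index with \<open>e i \<ge> b\<close>, then \<open>b < e i\<close> would make
  \<open>i\<close> a limit index, and continuity would provide an earlier value above \<open>b\<close>.\<close>

lemma normal_map_range_club:
  assumes p: "Well_order p" and m: "Well_order m" and e: "normal_map p m e d"
  shows "club m (underS m d) (e ` Field p)"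
  unfolding club_def
proof (intro conjI ballI impI)
  show "e ` Field p \<subseteq> underS m d" using e unfolding normal_map_def by blast
  show "\<exists>c\<in>e ` Field p. lt m a c" if "a \<in> underS m d" for a
    using e that unfolding normal_map_def by blast
  fix b assume b: "b \<in> underS m d"
    and lim: "\<forall>a. lt m a b \<longrightarrow> (\<exists>c\<in>e ` Field p. lt m a c \<and> lt m c b)"
  have mono: "lt m (e i) (e j)" if "lt p i j" for i j using e that unfolding normal_map_def by blast
  have eF: "e i \<in> Field m" if "i \<in> Field p" for i
    using e that lt_in_Field(1) unfolding normal_map_def by metis
  have refl: "lt p i j" if ij: "i \<in> Field p" "j \<in> Field p" "lt m (e i) (e j)" for i j
  proof -
    have "\<not> lt p j i \<and> i \<noteq> j" using mono[of j i] lt_trans[OF m, of "e i" "e j" "e i"] ij(3) by auto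
    then show ?thesis using lt_linear[OF p ij(1,2)] by blast
  qed
  obtain i0 where "i0 \<in> Field p" "lt m b (e i0)" using e b unfolding normal_map_def by blast
  then have "i0 \<in> Field p \<and> \<not> lt m (e i0) b" using lt_trans[OF m] lt_irrefl by metis
  from exists_lt_least[OF p, of "\<lambda>i. i \<in> Field p \<and> \<not> lt m (e i) b", OF this]
  obtain i where i: "i \<in> Field p" "\<not> lt m (e i) b" and least: "\<And>j. lt p j i \<Longrightarrow> lt m (e j) b"
    using lt_in_Field(1) by metis
  have "\<not> lt m b (e i)"
  proof
    assume bi: "lt m b (e i)"
    have "\<exists>j'. lt p j j' \<and> lt p j' i" if j: "lt p j i" for j
    proof -
      obtain j' where "j' \<in> Field p" "lt m (e j) (e j')" "lt m (e j') b"
        using lim least[OF j] by blast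
      then show ?thesis using refl lt_trans[OF m] bi i(1) lt_in_Field(1)[OF j] by meson
    qed
    then obtain j where "lt p j i" "lt m b (e j)" using e i(1) bi unfolding normal_map_def by blast
    then show False using least[of j] lt_trans[OF m] lt_irrefl by metis
  qed
  then have "e i = b" using lt_linear[OF m eF[OF i(1)] lt_in_Field(1)[OF b]] i(2) by blast
  then show "b \<in> e ` Field p" using i(1) by blast
qed

lemma normal_map_directed:
  assumes p: "Well_order p" and m: "Well_order m" and e: "normal_map p m e d"
    and dir: "directed p (Field p) k"
  shows "directed m (underS m d) k"
  unfolding directed_def
proof (intro allI impI)
  fix D assume D: "D \<subseteq> underS m d" "|D| <o k"
  have "\<exists>i\<in>Field p. lt m x (e i)" if "x \<in> D" for x
    using e D(1) that unfolding normal_map_def by blast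
  then obtain g where g: "\<And>x. x \<in> D \<Longrightarrow> g x \<in> Field p \<and> lt m x (e (g x))" by metis
  then obtain b where b: "b \<in> Field p" "\<And>x. x \<in> D \<Longrightarrow> lt p (g x) b"
    using directed_family[OF dir D(2), of g] by blast
  then have "lt m x (e b)" if "x \<in> D" for x
    using g[OF that] b(2)[OF that] e lt_trans[OF m] unfolding normal_map_def by blast
  then show "\<exists>b\<in>underS m d. \<forall>x\<in>D. lt m x b" using b(1) e unfolding normal_map_def by blast
qed

text \<open>The set of indices is unbounded because \<open>E\<close> meets the range of \<open>e\<close>, itself a club, in a club.\<close>

lemma normal_map_vimage_club:
  assumes p: "Well_order p" and m: "Well_order m" and e: "normal_map p m e d"
    and dir: "directed m (underS m d) k" and k: "natLeq <o k" and E: "club m (underS m d) E"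
  shows "club p (Field p) {i \<in> Field p. e i \<in> E}"
proof -
  have ini: "underS m d \<subseteq> Field m" "\<forall>a\<in>underS m d. underS m a \<subseteq> underS m d"
    using lt_in_Field(1)[of _ m d] lt_trans[OF m, of _ _ d] by blast+
  have int: "club m (underS m d) (E \<inter> e ` Field p)"
    using club_Int[OF m ini dir k E normal_map_range_club[OF p m e]] .
  have mono: "lt m (e i) (e j)" if "lt p i j" for i j using e that unfolding normal_map_def by blast
  have ed: "lt m (e i) d" if "i \<in> Field p" for i using e that unfolding normal_map_def by blast
  show ?thesis unfolding club_def
  proof (intro conjI ballI impI)
    fix i assume i: "i \<in> Field p"
    obtain j where j: "j \<in> Field p" "e j \<in> E" "lt m (e i) (e j)"
      using clubD(2)[OF int ed[OF i]] by blast
    have "\<not> lt p j i \<and> i \<noteq> j" using mono[of j i] lt_trans[OF m, of "e i" "e j" "e i"] j(3) by auto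
    then show "\<exists>c\<in>{i \<in> Field p. e i \<in> E}. lt p i c" using lt_linear[OF p i j(1)] j by blast
  next
    fix i assume i: "i \<in> Field p"
      and lim: "\<forall>a. lt p a i \<longrightarrow> (\<exists>c\<in>{i \<in> Field p. e i \<in> E}. lt p a c \<and> lt p c i)"
    have "e i \<in> E"
    proof (rule clubD(3)[OF E ed[OF i]])
      fix a assume "lt m a (e i)"
      then obtain j where j: "lt p j i" "lt m a (e j)"
        using e i lim unfolding normal_map_def by blast
      obtain c where "c \<in> Field p" "e c \<in> E" "lt p j c" "lt p c i" using lim j(1) by blast
      then show "\<exists>c\<in>E. lt m a c \<and> lt m c (e i)"
        using j(2) mono lt_trans[OF m] by blast
    qed
    then show "i \<in> {i \<in> Field p. e i \<in> E}" using i by blast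
  qed blast
qed

section \<open>Club guessing\<close>

lemma card_ge_if_unbounded:
  assumes r: "Well_order r" and k: "Card_order k" and dir: "directed r A k"
    and D: "D \<subseteq> A" "\<forall>a\<in>A. \<exists>c\<in>D. lt r a c"
  shows "k \<le>o |D|"
proof (rule ccontr)
  assume "\<not> k \<le>o |D|"
  then have "|D| <o k"
    using not_ordLeq_iff_ordLess[OF card_of_Well_order Card_order_Well_order[OF k]] by blast
  then obtain b where b: "b \<in> A" "\<forall>d\<in>D. lt r d b"
    using dir D(1) unfolding directed_def by blast
  then obtain c where c: "c \<in> D" "lt r b c" using D(2) by blast
  then show False using b(2) lt_trans[OF r c(2), of b] by simp
qed

lemma Card_order_nomax:
  assumes "Card_order k" "natLeq \<le>o k" "i \<in> Field k"
  shows "\<exists>j. lt k i j"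
proof -
  have "\<not> finite (Field k)"
    using assms(1,2) Card_order_iff_ordLeq_card_of infinite_iff_natLeq_ordLeq ordLeq_transitive
    by blast
  then show ?thesis
    using infinite_Card_order_limit[OF assms(1) _ assms(3)] unfolding underS_def by blast
qed

lemma infinite_Field_if_natLeq:
  assumes "Card_order k" "natLeq \<le>o k" shows "\<not> finite (Field k)"
  using assms Card_order_iff_ordLeq_card_of infinite_iff_natLeq_ordLeq ordLeq_transitive by blast

text \<open>The first \<open>k\<close> elements of \<open>E\<close>. This exhibits a point \<open>a\<close> of cofinality \<open>k\<close> that is a limit of \<open>E\<close>.\<close>

lemma club_contains_normal_map:
  assumes k: "Card_order k" "natLeq \<le>o k"
    and m: "Card_order m" "regularCard m" "k <o m" and E: "club m (Field m) E"
  obtains e a where "normal_map k m e a" "e ` Field k \<subseteq> E"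
proof -
  have wk: "Well_order k" and wm: "Well_order m" using k m Card_order_Well_order by auto
  have infm: "\<not> finite (Field m)"
    using infinite_Field_if_natLeq[OF m(1)] k(2) m(3) ordLeq_ordLess_trans ordLess_imp_ordLeq by blast
  have dir: "directed m (Field m) m"
    using Field_directed[OF m(1,2) infm ordLeq_reflexive[OF wm]] .
  define nx where "nx x = (SOME c. c \<in> E \<and> lt m x c)" for x
  have nx: "nx x \<in> E" "lt m x (nx x)" if "x \<in> Field m" for x
  proof -
    have "\<exists>c. c \<in> E \<and> lt m x c" using clubD(2)[OF E that] by blast
    from someI_ex[OF this] show "nx x \<in> E" "lt m x (nx x)" unfolding nx_def by auto
  qed
  obtain e where e: "\<And>i. i \<in> Field k \<Longrightarrow> e i \<in> Field m"
    "\<And>i j. lt k j i \<Longrightarrow> \<not> lt m (e i) (nx (e j))"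
    "\<And>i u. i \<in> Field k \<Longrightarrow> lt m u (e i) \<Longrightarrow> \<exists>j. lt k j i \<and> lt m u (nx (e j))"
  proof (rule continuous_recursion[OF wk wm, of m "\<lambda>e j. nx (e j)"])
    show "|underS k i| <o m" if "i \<in> Field k" for i
      using ordLess_transitive[OF card_of_underS[OF k(1) that] m(3)] .
  qed (use dir nx in auto)
  have fk: "|Field k| <o m"
    using card_of_Field_ordIso[OF k(1)] m(3) ordIso_ordLess_trans by blast
  obtain a where a: "normal_map k m e a"
    using normal_mapI[OF wk wm Card_order_nomax[OF k] fk dir e(1) nx(2)[OF e(1)] e(2,3)] by blast
  have "e i \<in> E" if i: "i \<in> Field k" for i
  proof (cases "\<exists>j. lt k j i \<and> e i = nx (e j)")
    case True
    then show ?thesis using nx(1) e(1) lt_in_Field(1) by metis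
  next
    case False
    show ?thesis
    proof (rule clubD(3)[OF E e(1)[OF i]])
      fix x assume "lt m x (e i)"
      then obtain j where j: "lt k j i" "lt m x (nx (e j))" using e(3)[OF i] by blast
      have jE: "nx (e j) \<in> E" using nx(1) e(1) lt_in_Field(1)[OF j(1)] by blast
      have "lt m (nx (e j)) (e i)"
        using lt_linear[OF wm lt_in_Field(2)[OF j(2)] e(1)[OF i]] e(2)[OF j(1)] False j(1) by metis
      then show "\<exists>c\<in>E. lt m x c \<and> lt m c (e i)" using jE j(2) by blast
    qed
  qed
  then show thesis using that a by blast
qed

text \<open>Shelah's club guessing, in the easy case of an uncountable \<open>k\<close> whose successor is below \<open>m\<close>.
  Fix clubs \<open>C0 a\<close> of size at most \<open>k\<close> in the points \<open>a\<close> that have one. Some club \<open>E\<close> makes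
  \<open>a \<mapsto> C0 a \<inter> E\<close> a guessing sequence: otherwise each \<open>E\<close> has a club \<open>Fn E\<close> that is not guessed, and one
  shrinks \<open>E\<close> to \<open>Fn E\<close> again and again, \<open>cardSuc k\<close> times. At a point \<open>a\<close> of cofinality \<open>k\<close> that is a
  limit of all the clubs so obtained, each step removes an element of \<open>C0 a\<close>, which has only \<open>k\<close>
  elements.\<close>

lemma club_guessing:
  fixes k :: "'k rel" and m :: "'m rel"
  assumes k: "Card_order k" "regularCard k" "natLeq <o k"
    and m: "Card_order m" "regularCard m" "cardSuc k <o m"
  obtains C :: "'m \<Rightarrow> 'm set" where
    "\<And>F. club m (Field m) F \<Longrightarrow> \<exists>a\<in>Field m. C a \<subseteq> F \<and> k \<le>o |C a|"
proof (rule ccontr)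
  assume neg: "\<not> thesis"
  have wk: "Well_order k" and wm: "Well_order m" using k m Card_order_Well_order by auto
  have nk: "natLeq \<le>o k" using k(3) ordLess_imp_ordLeq by blast
  have km: "k <o m" using cardSuc_greater[OF k(1)] m(3) ordLess_transitive by blast
  have nm: "natLeq <o m" using k(3) km ordLess_transitive by blast
  have infm: "\<not> finite (Field m)"
    using infinite_Field_if_natLeq[OF m(1)] nm ordLess_imp_ordLeq by blast
  have dir: "directed m (Field m) m"
    using Field_directed[OF m(1,2) infm ordLeq_reflexive[OF wm]] .
  have dirk: "directed k (Field k) k"
    using Field_directed[OF k(1,2) infinite_Field_if_natLeq[OF k(1) nk] ordLeq_reflexive[OF wk]] .
  have iniF: "Field m \<subseteq> Field m" "\<forall>a\<in>Field m. underS m a \<subseteq> Field m"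
    using lt_in_Field(1)[of _ m] by blast+
  define s where "s = cardSuc k"
  have s: "Card_order s" "s <o m" "k <o s"
    using cardSuc_Card_order[OF k(1)] m(3) cardSuc_greater[OF k(1)] unfolding s_def by auto
  have ws: "Well_order s" using s(1) Card_order_Well_order by auto
  define C0 where "C0 a = (SOME D. club m (underS m a) D \<and> |D| \<le>o k)" for a
  have "\<exists>F. club m (Field m) F \<and> (\<forall>a\<in>Field m. C0 a \<inter> E \<subseteq> F \<longrightarrow> \<not> k \<le>o |C0 a \<inter> E| )" for E
    using neg that[of "\<lambda>a. C0 a \<inter> E"] by blast
  then obtain Fn where Fn: "\<And>E. club m (Field m) (Fn E)"
    "\<And>E a. a \<in> Field m \<Longrightarrow> C0 a \<inter> E \<subseteq> Fn E \<Longrightarrow> \<not> k \<le>o |C0 a \<inter> E|" by metis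
  (* X z is the club reached after z steps of shrinking. *)
  define H where "H X z = Field m \<inter> (\<Inter>y\<in>underS s z. Fn (X y))" for X z
  have "adm_wf {(x, y). lt s x y} H" unfolding adm_wf_def H_def by auto
  then obtain X where X: "X = H X" using wfrec_fixpoint[OF wf_lt[OF ws]] by blast
  have Xz: "X z = Field m \<inter> (\<Inter>y\<in>underS s z. Fn (X y))" for z
    using X unfolding H_def by metis
  have clX: "club m (Field m) (X z)" if "z \<in> Field s" for z
    unfolding Xz[of z]
    by (rule club_Inter[OF wm iniF dir nm])
      (use ordLess_transitive[OF card_of_underS[OF s(1) that] s(2)] Fn(1) in auto)
  define E where "E = Field m \<inter> (\<Inter>z\<in>Field s. X z)"
  have fs: "|Field s| <o m"
    using card_of_Field_ordIso[OF s(1)] s(2) ordIso_ordLess_trans by blast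
  have clE: "club m (Field m) E"
    unfolding E_def using clX by (intro club_Inter[OF wm iniF dir nm fs])
  obtain e a where ea: "normal_map k m e a" "e ` Field k \<subseteq> E"
    using club_contains_normal_map[OF k(1) nk m(1,2) km clE] .
  let ?A = "underS m a"
  have rng: "club m ?A (e ` Field k)" using normal_map_range_club[OF wk wm ea(1)] .
  have dirA: "directed m ?A k" using normal_map_directed[OF wk wm ea(1) dirk] .
  have iniA: "?A \<subseteq> Field m" "\<forall>b\<in>?A. underS m b \<subseteq> ?A"
    using lt_in_Field(1)[of _ m a] lt_trans[OF wm, of _ _ a] by blast+
  have "|e ` Field k| \<le>o k"
    using card_of_image card_of_Field_ordIso[OF k(1)] ordLeq_ordIso_trans by blast
  with rng have "\<exists>D. club m ?A D \<and> |D| \<le>o k" by blast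
  from someI_ex[OF this] have C0: "club m ?A (C0 a)" "|C0 a| \<le>o k" unfolding C0_def by auto
  have EA: "club m ?A (E \<inter> ?A)"
    unfolding club_def
  proof (intro conjI ballI impI)
    fix b assume "b \<in> ?A"
    then obtain c where "c \<in> e ` Field k" "lt m b c" using clubD(2)[OF rng] by blast
    then show "\<exists>c\<in>E \<inter> ?A. lt m b c" using clubD(1)[OF rng] ea(2) by blast
  next
    fix b assume b: "b \<in> ?A" and lim: "\<forall>x. lt m x b \<longrightarrow> (\<exists>c\<in>E \<inter> ?A. lt m x c \<and> lt m c b)"
    have "b \<in> E" using clubD(3)[OF clE, of b] b iniA(1) lim by blast
    then show "b \<in> E \<inter> ?A" using b by blast
  qed blast
  (* C0 a and E are clubs in a, which has uncountable cofinality k; so they meet in a club of a. *)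
  have big: "k \<le>o |C0 a \<inter> X z|" if z: "z \<in> Field s" for z
  proof -
    have "club m ?A (C0 a \<inter> (E \<inter> ?A))" by (rule club_Int[OF wm iniA dirA k(3) C0(1) EA])
    then have "k \<le>o |C0 a \<inter> (E \<inter> ?A)|"
      using card_ge_if_unbounded[OF wm k(1) dirA] clubD(1,2) by metis
    moreover have "C0 a \<inter> (E \<inter> ?A) \<subseteq> C0 a \<inter> X z" using z unfolding E_def by blast
    ultimately show ?thesis using card_of_mono1 ordLeq_transitive by blast
  qed
  obtain i0 where "i0 \<in> Field k" using infinite_Field_if_natLeq[OF k(1) nk] by fastforce
  then have aF: "a \<in> Field m" using ea(1) lt_in_Field(2) unfolding normal_map_def by metis
  have "\<exists>x. x \<in> C0 a \<inter> X z \<and> x \<notin> Fn (X z)" if "z \<in> Field s" for z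
    using Fn(2)[OF aF, of "X z"] big[OF that] by blast
  then obtain x where x: "\<And>z. z \<in> Field s \<Longrightarrow> x z \<in> C0 a \<inter> X z \<and> x z \<notin> Fn (X z)" by metis
  have sep: "x y \<noteq> x z" if "lt s y z" for y z
  proof -
    have "x z \<in> X z" "x y \<notin> Fn (X y)" using x lt_in_Field[OF that] by blast+
    then show ?thesis using that unfolding Xz[of z] by auto
  qed
  have "inj_on x (Field s)"
    using sep lt_linear[OF ws] by (intro inj_onI) metis
  moreover have "x ` Field s \<subseteq> C0 a" using x by blast
  ultimately have "|Field s| \<le>o |C0 a|" using card_of_ordLeq by blast
  then have "s \<le>o k"
    using C0(2) card_of_Field_ordIso[OF s(1)] ordIso_symmetric ordIso_ordLeq_trans ordLeq_transitive
    by blast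
  then show False using s(3) not_ordLess_ordLeq by blast
qed

section \<open>A spread-out family of functions\<close>

text \<open>The values at \<open>n\<close> are taken in the successor of the cardinality of \<open>n\<close>, so that any set of at most
  that many values is bounded. For \<open>n\<close> below a limit cardinal \<open>l\<close> this successor is still below \<open>l\<close>.\<close>

abbreviation level :: "'a rel \<Rightarrow> 'a \<Rightarrow> 'a set rel" where
  "level l n \<equiv> cardSuc |underS l n|"

lemma level_facts:
  assumes "natLeq \<le>o |underS l n|"
  shows "Well_order (level l n)" "directed (level l n) (Field (level l n)) (level l n)"
proof -
  have co: "Card_order (level l n)" using cardSuc_Card_order card_of_Card_order by blast
  then show w: "Well_order (level l n)" by (rule Card_order_Well_order)
  have inf: "\<not> finite (underS l n)" using assms infinite_iff_natLeq_ordLeq by blast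
  then have "regularCard (level l n)"
    using infinite_cardSuc_regularCard card_of_Card_order by (metis Field_card_of)
  moreover have "\<not> finite (Field (level l n))" using inf card_of_cardSuc_finite by blast
  ultimately show "directed (level l n) (Field (level l n)) (level l n)"
    using Field_directed[OF co] ordLeq_reflexive[OF w] by blast
qed

text \<open>Recursion on \<open>g\<close>. An injection \<open>h g\<close> of the predecessors of \<open>g\<close> into \<open>l\<close> writes them as an
  increasing union over \<open>n \<in> K\<close> of sets of at most \<open>|n|\<close> elements, and \<open>f g n\<close> is chosen above the
  values \<open>f b n\<close> of the \<open>b\<close> in the \<open>n\<close>-th set. A fixed \<open>b\<close> is in all sets from some \<open>n\<close> on, hence the
  sequence increases modulo initial segments of \<open>K\<close>. There is room for a further set \<open>E g\<close> of small
  size, dominated at every \<open>n\<close>.\<close>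

lemma slow_family:
  fixes l :: "'a rel" and m :: "'m rel"
  assumes l: "Well_order l" and m: "Well_order m"
    and seg: "\<And>g. g \<in> Field m \<Longrightarrow> |underS m g| \<le>o l"
    and K: "K \<subseteq> Field l" "\<And>x. x \<in> Field l \<Longrightarrow> \<exists>n\<in>K. lt l x n"
    and v: "natLeq \<le>o v" "\<And>n. n \<in> K \<Longrightarrow> v \<le>o |underS l n|"
    and E: "\<And>g. E g \<subseteq> underS m g" "\<And>g. |E g| \<le>o v"
  obtains f :: "'m \<Rightarrow> 'a \<Rightarrow> 'a set" where
    "\<And>g n. g \<in> Field m \<Longrightarrow> n \<in> K \<Longrightarrow> f g n \<in> Field (level l n)"
    "\<And>b g. lt m b g \<Longrightarrow> \<exists>i\<in>K. \<forall>n\<in>K. \<not> lt l n i \<longrightarrow> lt (level l n) (f b n) (f g n)"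
    "\<And>b g n. g \<in> Field m \<Longrightarrow> b \<in> E g \<Longrightarrow> n \<in> K \<Longrightarrow> lt (level l n) (f b n) (f g n)"
proof -
  have nat: "natLeq \<le>o |underS l n|" if "n \<in> K" for n
    using v(1) v(2)[OF that] ordLeq_transitive by blast
  have "\<exists>h. inj_on h (underS m g) \<and> h ` underS m g \<subseteq> Field l" if "g \<in> Field m" for g
  proof -
    have "|underS m g| \<le>o |Field l|" using card_of_mono2[OF seg[OF that]] unfolding Field_card_of .
    then show ?thesis using card_of_ordLeq by blast
  qed
  then obtain h where h: "\<And>g. g \<in> Field m \<Longrightarrow> inj_on (h g) (underS m g)"
    "\<And>g. g \<in> Field m \<Longrightarrow> h g ` underS m g \<subseteq> Field l" by metis
  define A where "A g n = E g \<union> {b \<in> underS m g. lt l (h g b) n}" for g n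
  have A_lt: "A g n \<subseteq> underS m g" for g n using E(1) unfolding A_def by blast
  have A_card: "|A g n| <o level l n" if "g \<in> Field m" "n \<in> K" for g n
  proof -
    let ?B = "{b \<in> underS m g. lt l (h g b) n}"
    have inj: "inj_on (h g) ?B"
      using h(1)[OF that(1)] by (rule inj_on_subset) blast
    have "|?B| \<le>o |underS l n|"
      by (rule card_of_ordLeq[THEN iffD1]) (use inj in blast)
    moreover have "|E g| \<le>o |underS l n|"
      using E(2) v(2)[OF that(2)] ordLeq_transitive by blast
    moreover have "\<not> finite (underS l n)"
      using nat[OF that(2)] infinite_iff_natLeq_ordLeq by blast
    ultimately have "|A g n| \<le>o |underS l n|"
      unfolding A_def
      by (intro card_of_Un_ordLeq_infinite_Field) (auto simp: Field_card_of card_of_card_order_on)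
    then show ?thesis using cardSuc_greater[OF card_of_Card_order] ordLeq_ordLess_trans by blast
  qed
  define H where "H f g = (\<lambda>n. SOME w. w \<in> Field (level l n) \<and> (\<forall>b\<in>A g n. lt (level l n) (f b n) w))"
    for f :: "'m \<Rightarrow> 'a \<Rightarrow> 'a set" and g
  have "adm_wf {(x, y). lt m x y} H"
    unfolding adm_wf_def
  proof (intro allI impI)
    fix f f' :: "'m \<Rightarrow> 'a \<Rightarrow> 'a set" and g
    assume "\<forall>z. (z, g) \<in> {(x, y). lt m x y} \<longrightarrow> f z = f' z"
    then have "\<forall>b\<in>A g n. f b = f' b" for n using A_lt by blast
    then show "H f g = H f' g" unfolding H_def by auto
  qed
  then obtain f where f: "f = H f" using wfrec_fixpoint[OF wf_lt[OF m]] by blast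
  have main: "g \<in> Field m \<longrightarrow> (\<forall>n\<in>K. f g n \<in> Field (level l n) \<and> (\<forall>b\<in>A g n. lt (level l n) (f b n) (f g n)))" for g
  proof (induction g rule: wf_induct_rule[OF wf_lt[OF m]])
    case (1 g)
    show ?case
    proof (intro impI ballI)
      fix n assume g: "g \<in> Field m" and n: "n \<in> K"
      have "\<forall>b\<in>A g n. f b n \<in> Field (level l n)"
        using 1 A_lt[of g n] lt_in_Field(1)[of _ m g] n by blast
      then have "\<exists>w. w \<in> Field (level l n) \<and> (\<forall>b\<in>A g n. lt (level l n) (f b n) w)"
        using directed_family[OF level_facts(2)[OF nat[OF n]] A_card[OF g n], of "\<lambda>b. f b n"] by blast
      from someI_ex[OF this]
      show "f g n \<in> Field (level l n) \<and> (\<forall>b\<in>A g n. lt (level l n) (f b n) (f g n))"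
        using fun_cong[OF fun_cong[OF f, of g], of n] unfolding H_def by simp
    qed
  qed
  show thesis
  proof
    show "f g n \<in> Field (level l n)" if "g \<in> Field m" "n \<in> K" for g n using main that by blast
    show "lt (level l n) (f b n) (f g n)" if "g \<in> Field m" "b \<in> E g" "n \<in> K" for b g n
      using main that unfolding A_def by blast
    show "\<exists>i\<in>K. \<forall>n\<in>K. \<not> lt l n i \<longrightarrow> lt (level l n) (f b n) (f g n)" if bg: "lt m b g" for b g
    proof -
      have g: "g \<in> Field m" using lt_in_Field(2)[OF bg] .
      have "h g b \<in> Field l" using h(2)[OF g] bg by blast
      then obtain i where i: "i \<in> K" "lt l (h g b) i" using K(2) by blast
      have "lt (level l n) (f b n) (f g n)" if n: "n \<in> K" "\<not> lt l n i" for n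
      proof -
        have "lt l (h g b) n" using lt_not_lt_trans[OF l i(2) n(2)] K(1) n(1) by blast
        then have "b \<in> A g n" using bg unfolding A_def by blast
        then show ?thesis using main g n(1) by blast
      qed
      then show ?thesis using i(1) by blast
    qed
  qed
qed

lemma large_fibre:
  assumes k: "Card_order k" "regularCard k" "natLeq \<le>o k"
    and K: "|K| <o k" and C: "k \<le>o |C|" and g: "g ` C \<subseteq> K"
  obtains n where "n \<in> K" "k \<le>o |{i \<in> C. g i = n}|"
proof (rule ccontr)
  assume neg: "\<not> thesis"
  note pick = that
  have small: "|{i \<in> C. g i = n}| <o k" if "n \<in> K" for n
    using neg pick[OF that]
      not_ordLeq_iff_ordLess[OF card_of_Well_order Card_order_Well_order[OF k(1)]] by blast
  have "Cinfinite k"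
    using infinite_Field_if_natLeq[OF k(1,3)] k(1) unfolding cinfinite_def by blast
  then have "|\<Union>n\<in>K. {i \<in> C. g i = n}| <o k"
    by (rule regularCard_UNION_bound[OF _ k(2) K]) (rule small)
  moreover have "(\<Union>n\<in>K. {i \<in> C. g i = n}) = C" using g by blast
  ultimately show False using C not_ordLess_ordLeq by auto
qed

text \<open>For \<open>E d\<close> take a club of size at most \<open>c\<close> in \<open>d\<close>, where there is one. Given a cofinal \<open>X\<close>, build a
  continuous \<open>e\<close> of length \<open>c\<close> and points \<open>x i \<in> X\<close> with \<open>e i < x i < e (i + 1)\<close>. The point \<open>x i\<close> is
  asked to dominate, for each set \<open>C a\<close> of a guessing sequence on \<open>c\<close>, the functions with indices
  \<open>e j\<close>, \<open>j \<in> C a\<close>, \<open>j \<le> i\<close>, provided that any member of the family does: only \<open>c\<close> many requests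
  arise at step \<open>i\<close>, although the club that will matter is not yet known. At the supremum \<open>d\<close> of \<open>e\<close>,
  the indices with \<open>e i \<in> E d\<close> form a club, so they include some \<open>C a\<close> of size at least \<open>k\<close>. For this
  \<open>a\<close> the requests were satisfiable, by \<open>f d\<close>. Thus for \<open>i < j\<close> in \<open>C a\<close>, with \<open>i'\<close> the successor of \<open>i\<close>
  in \<open>C a\<close>, one has \<open>f (x i) < f (e i') < f (x j)\<close> from some \<open>n\<close> on. The \<open>n\<close> for the first inequality
  depends on \<open>i\<close> alone, the one for the second on \<open>j\<close> alone. As \<open>|K| < k\<close>, a single \<open>n\<close> serves \<open>k\<close> many
  elements of \<open>C a\<close>, and along them \<open>f (x i) n\<close> is strictly increasing.\<close>

lemma spread_family:
  fixes k :: "'k rel" and l :: "'a rel" and m :: "'m rel" and c :: "'c rel"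
  assumes k: "Card_order k" "regularCard k" "natLeq <o k"
    and c: "Card_order c" "regularCard c" "cardSuc k <o c"
    and l: "Well_order l"
    and m: "Card_order m" "regularCard m" "c <o m"
    and seg: "\<And>g. g \<in> Field m \<Longrightarrow> |underS m g| \<le>o l"
    and K: "K \<subseteq> Field l" "\<And>x. x \<in> Field l \<Longrightarrow> \<exists>n\<in>K. lt l x n" "|K| <o k" "K \<noteq> {}"
    and big: "\<And>n. n \<in> K \<Longrightarrow> c \<le>o |underS l n|"
  obtains f :: "'m \<Rightarrow> 'a \<Rightarrow> 'a set" where
    "\<And>g n. g \<in> Field m \<Longrightarrow> n \<in> K \<Longrightarrow> f g n \<in> Field (level l n)"
    "\<And>X. X \<subseteq> Field m \<Longrightarrow> cofinal X m \<Longrightarrow> \<exists>n\<in>K. k \<le>o |(\<lambda>x. f x n) ` X|"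
proof -
  have wm: "Well_order m" and wc: "Well_order c" using m c Card_order_Well_order by auto
  have nc: "natLeq <o c"
    using ordLess_transitive[OF ordLess_transitive[OF k(3) cardSuc_greater[OF k(1)]] c(3)] .
  have nk: "natLeq \<le>o k" and nc': "natLeq \<le>o c" using k(3) nc ordLess_imp_ordLeq by auto
  have nm: "natLeq \<le>o m" using nc m(3) ordLess_transitive ordLess_imp_ordLeq by blast
  have dir: "directed m (Field m) m"
    using Field_directed[OF m(1,2) infinite_Field_if_natLeq[OF m(1) nm] ordLeq_reflexive[OF wm]] .
  have dirc: "directed c (Field c) c"
    using Field_directed[OF c(1,2) infinite_Field_if_natLeq[OF c(1) nc'] ordLeq_reflexive[OF wc]] .
  define E where "E d = (if \<exists>D. club m (underS m d) D \<and> |D| \<le>o c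
    then SOME D. club m (underS m d) D \<and> |D| \<le>o c else {})" for d
  have E1: "club m (underS m d) (E d) \<and> |E d| \<le>o c"
    if "\<exists>D. club m (underS m d) D \<and> |D| \<le>o c" for d
    using someI_ex[OF that] unfolding E_def if_P[OF that] .
  have E2: "E d \<subseteq> underS m d" "|E d| \<le>o c" for d
  proof -
    have "E d \<subseteq> underS m d \<and> |E d| \<le>o c"
    proof (cases "\<exists>D. club m (underS m d) D \<and> |D| \<le>o c")
      case True
      then show ?thesis using E1[OF True] clubD(1) by blast
    next
      case False
      then have "E d = {}" unfolding E_def by (rule if_not_P)
      then show ?thesis using card_of_empty1[OF disjI1, OF wc] by simp
    qed
    then show "E d \<subseteq> underS m d" "|E d| \<le>o c" by auto
  qed
  obtain f :: "'m \<Rightarrow> 'a \<Rightarrow> 'a set" where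
    f1: "\<And>g n. g \<in> Field m \<Longrightarrow> n \<in> K \<Longrightarrow> f g n \<in> Field (level l n)" and
    f2: "\<And>b g. lt m b g \<Longrightarrow> \<exists>i\<in>K. \<forall>n\<in>K. \<not> lt l n i \<longrightarrow> lt (level l n) (f b n) (f g n)" and
    f3: "\<And>b g n. g \<in> Field m \<Longrightarrow> b \<in> E g \<Longrightarrow> n \<in> K \<Longrightarrow> lt (level l n) (f b n) (f g n)"
    using slow_family[OF l wm seg K(1,2) nc' big E2] by blast
  have wl: "Well_order (level l n)" if "n \<in> K" for n
    by (rule level_facts(1)[OF ordLeq_transitive[OF nc' big[OF that]]])
  obtain C :: "'c \<Rightarrow> 'c set" where
    C: "\<And>F. club c (Field c) F \<Longrightarrow> \<exists>a\<in>Field c. C a \<subseteq> F \<and> k \<le>o |C a|"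
    using club_guessing[OF k c] by blast
  have max: "\<exists>i\<in>K. \<forall>n\<in>K. \<not> lt l n i \<longrightarrow> \<not> lt l n i1 \<and> \<not> lt l n i2"
    if i12: "i1 \<in> K" "i2 \<in> K" for i1 i2
  proof -
    consider "lt l i1 i2" | "i1 = i2" | "lt l i2 i1"
      using lt_linear[OF l, of i1 i2] K(1) i12 by blast
    then show ?thesis
    proof cases
      case 1 then show ?thesis using lt_trans[OF l] that by blast
    next
      case 2 then show ?thesis using that by blast
    next
      case 3 then show ?thesis using lt_trans[OF l] that by blast
    qed
  qed
  define dominated where "dominated S x \<longleftrightarrow> (\<exists>i\<in>K. \<forall>n\<in>K. \<not> lt l n i \<longrightarrow> (\<forall>b\<in>S. lt (level l n) (f b n) (f x n)))" for S x
  have dominated_mono: "dominated S x" if Sz: "dominated S z" and zx: "lt m z x" for S x z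
  proof -
    obtain i1 where i1: "i1 \<in> K" "\<forall>n\<in>K. \<not> lt l n i1 \<longrightarrow> (\<forall>b\<in>S. lt (level l n) (f b n) (f z n))"
      using Sz unfolding dominated_def by blast
    obtain i2 where i2: "i2 \<in> K" "\<forall>n\<in>K. \<not> lt l n i2 \<longrightarrow> lt (level l n) (f z n) (f x n)"
      using f2[OF zx] by blast
    obtain i where i: "i \<in> K" "\<forall>n\<in>K. \<not> lt l n i \<longrightarrow> \<not> lt l n i1 \<and> \<not> lt l n i2"
      using max[OF i1(1) i2(1)] by blast
    have "lt (level l n) (f b n) (f x n)" if "n \<in> K" "\<not> lt l n i" "b \<in> S" for n b
    proof (rule lt_trans[OF wl[OF that(1)]])
      show "lt (level l n) (f b n) (f z n)" using i1(2) i(2) that by blast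
      show "lt (level l n) (f z n) (f x n)" using i2(2) i(2) that by blast
    qed
    then show ?thesis unfolding dominated_def using i(1) by blast
  qed
  have spread: "\<exists>n\<in>K. k \<le>o |(\<lambda>x. f x n) ` X|" if X: "X \<subseteq> Field m" "cofinal X m" for X
  proof -
    have cof: "\<exists>x\<in>X. lt m y x" if "y \<in> Field m" for y
      using X(2) that unfolding cofinal_def underS_def by blast
    (* G e j is the next value of e; R records the point x of X placed between e j and it. *)
    define past where "past e a j = e ` {i \<in> C a. i = j \<or> lt c i j}" for e :: "'c \<Rightarrow> 'm" and a j
    define R where "R e j x u \<longleftrightarrow> x \<in> X \<and> lt m (e j) x \<and> lt m x u \<and>
      (\<forall>a\<in>Field c. (\<exists>z\<in>Field m. dominated (past e a j) z) \<longrightarrow> dominated (past e a j) x)" for e j x u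
    define G where "G e j = (SOME u. \<exists>x. R e j x u)" for e j
    have Rex: "\<exists>u x. R e j x u" if ej: "e j \<in> Field m" for e j
    proof -
      (* z a is a member that dominates, if there is one; otherwise a harmless default. *)
      define z where "z a = (if \<exists>z\<in>Field m. dominated (past e a j) z
        then SOME z. z \<in> Field m \<and> dominated (past e a j) z else e j)" for a
      have z: "z a \<in> Field m" "(\<exists>z\<in>Field m. dominated (past e a j) z) \<Longrightarrow> dominated (past e a j) (z a)" for a
        using someI_ex[of "\<lambda>z. z \<in> Field m \<and> dominated (past e a j) z"] ej unfolding z_def by auto
      have fc: "|Field c| <o m"
        using card_of_Field_ordIso[OF c(1)] m(3) ordIso_ordLess_trans by blast
      obtain b where b: "b \<in> Field m" "\<forall>a\<in>Field c. lt m (z a) b"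
        using directed_family[OF dir fc, of z] z(1) by blast
      obtain x1 where x1: "x1 \<in> X" "lt m b x1" using cof[OF b(1)] by blast
      obtain x2 where x2: "x2 \<in> X" "lt m (e j) x2" using cof[OF ej] by blast
      have "\<exists>x\<in>X. lt m b x \<and> lt m (e j) x"
      proof (cases "lt m x1 x2")
        case True
        then show ?thesis using x1 x2 lt_trans[OF wm x1(2)] by blast
      next
        case False
        then have "lt m (e j) x1" using lt_not_lt_trans[OF wm x2(2) False] x1(1) X(1) by blast
        then show ?thesis using x1 by blast
      qed
      then obtain x where x: "x \<in> X" "lt m b x" "lt m (e j) x" by blast
      obtain u where u: "lt m x u" using cof[of x] x(1) X(1) by blast
      have "dominated (past e a j) x" if "a \<in> Field c" "\<exists>z\<in>Field m. dominated (past e a j) z" for a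
        using dominated_mono[OF z(2)[OF that(2)]] lt_trans[OF wm _ x(2)] b(2) that(1) by blast
      then have "R e j x u" unfolding R_def using x u by blast
      then show ?thesis by blast
    qed
    have RG: "\<exists>x. R e j x (G e j)" if "e j \<in> Field m" for e j
      unfolding G_def using someI_ex[OF Rex[of e j, OF that]] .
    have Glt: "lt m (e j) (G e j)" if "e j \<in> Field m" for e j
      using RG[of e j, OF that] lt_trans[OF wm] unfolding R_def by blast
    obtain e where e1: "\<And>i. i \<in> Field c \<Longrightarrow> e i \<in> Field m"
      and e2: "\<And>i j. lt c j i \<Longrightarrow> \<not> lt m (e i) (G e j)"
      and e3: "\<And>i u. i \<in> Field c \<Longrightarrow> lt m u (e i) \<Longrightarrow> \<exists>j. lt c j i \<and> lt m u (G e j)"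
    proof (rule continuous_recursion[OF wc wm, of m G])
      show "|underS c i| <o m" if "i \<in> Field c" for i
        using ordLess_transitive[OF card_of_underS[OF c(1) that] m(3)] .
      show "G e j = G e' j" if eq: "\<And>i. i = j \<or> lt c i j \<Longrightarrow> e i = e' i" for e e' j
      proof -
        have "past e a j = past e' a j" for a unfolding past_def using eq by auto
        then have "R e j = R e' j" unfolding R_def using eq by simp
        then show ?thesis unfolding G_def by simp
      qed
      show "lt m (e j) (G e j)" if "\<And>i. i = j \<or> lt c i j \<Longrightarrow> e i \<in> Field m" for e j
        using Glt that by blast
    qed (use dir in auto)
    have fc: "|Field c| <o m"
      using card_of_Field_ordIso[OF c(1)] m(3) ordIso_ordLess_trans by blast
    obtain d where d: "normal_map c m e d"
      using normal_mapI[OF wc wm Card_order_nomax[OF c(1) nc'] fc dir e1 Glt[OF e1] e2 e3] by blast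
    have mono: "lt m (e i) (e j)" if "lt c i j" for i j
      using d that unfolding normal_map_def by blast
    obtain i0 where "i0 \<in> Field c" using infinite_Field_if_natLeq[OF c(1) nc'] by fastforce
    then have dF: "d \<in> Field m" using d lt_in_Field(2) unfolding normal_map_def by metis
    have "|e ` Field c| \<le>o c"
      using card_of_image card_of_Field_ordIso[OF c(1)] ordLeq_ordIso_trans by blast
    then have Ed: "club m (underS m d) (E d)"
      using E1 normal_map_range_club[OF wc wm d] by blast
    have "club c (Field c) {i \<in> Field c. e i \<in> E d}"
      using normal_map_vimage_club[OF wc wm d normal_map_directed[OF wc wm d dirc] nc Ed] .
    from C[OF this] obtain a where a: "a \<in> Field c" "C a \<subseteq> {i \<in> Field c. e i \<in> E d}" "k \<le>o |C a|"
      by blast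
    have "\<exists>x. R e i x (G e i)" if "i \<in> C a" for i using RG e1 a(2) that by blast
    then obtain x where x: "\<And>i. i \<in> C a \<Longrightarrow> R e i (x i) (G e i)" by metis
    have domd: "dominated (past e a i) d" if "i \<in> C a" for i
    proof -
      have "past e a i \<subseteq> E d" using a(2) unfolding past_def by blast
      then have "lt (level l n) (f b n) (f d n)" if "b \<in> past e a i" "n \<in> K" for b n
        using f3[OF dF] that by blast
      then show ?thesis unfolding dominated_def using K(4) by blast
    qed
    have domx: "dominated (past e a i) (x i)" if "i \<in> C a" for i
      using x[OF that] a(1) dF domd[OF that] unfolding R_def by blast
    (* nx i is the successor of i in C a. It may fail to exist for a single i, a maximum of C a;
       such an i is never the smaller element of a pair. *)
    define nx where "nx i = (SOME j. j \<in> C a \<and> lt c i j \<and> (\<forall>j'\<in>C a. lt c i j' \<longrightarrow> \<not> lt c j' j))" for i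
    have nx: "nx i \<in> C a \<and> lt c i (nx i) \<and> (\<forall>j'\<in>C a. lt c i j' \<longrightarrow> \<not> lt c j' (nx i))"
      if "\<exists>j\<in>C a. lt c i j" for i
    proof -
      from that obtain j where "j \<in> C a \<and> lt c i j" by blast
      from exists_lt_least[OF wc, of "\<lambda>j. j \<in> C a \<and> lt c i j", OF this]
      have "\<exists>j. j \<in> C a \<and> lt c i j \<and> (\<forall>j'\<in>C a. lt c i j' \<longrightarrow> \<not> lt c j' j)" by blast
      from someI_ex[OF this] show ?thesis unfolding nx_def by blast
    qed
    have "\<exists>n\<in>K. (\<forall>b\<in>past e a i. lt (level l n) (f b n) (f (x i) n)) \<and>
        ((\<exists>j\<in>C a. lt c i j) \<longrightarrow> lt (level l n) (f (x i) n) (f (e (nx i)) n))" if i: "i \<in> C a" for i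
    proof -
      obtain i1 where i1: "i1 \<in> K"
        "\<forall>n\<in>K. \<not> lt l n i1 \<longrightarrow> (\<forall>b\<in>past e a i. lt (level l n) (f b n) (f (x i) n))"
        using domx[OF i] unfolding dominated_def by blast
      show ?thesis
      proof (cases "\<exists>j\<in>C a. lt c i j")
        case True
        have "\<not> lt m (e (nx i)) (G e i)" "e (nx i) \<in> Field m"
          using e2 e1 nx[OF True] a(2) by blast+
        then have "lt m (x i) (e (nx i))"
          using lt_not_lt_trans[OF wm, of "x i" "G e i" "e (nx i)"] x[OF i] unfolding R_def by blast
        from f2[OF this] obtain i2 where i2: "i2 \<in> K"
          "\<forall>n\<in>K. \<not> lt l n i2 \<longrightarrow> lt (level l n) (f (x i) n) (f (e (nx i)) n)" by blast
        obtain n where n: "n \<in> K" "\<not> lt l n i1" "\<not> lt l n i2"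
          using max[OF i1(1) i2(1)] lt_irrefl by metis
        then show ?thesis using i1(2) i2(2) by blast
      next
        case False
        then show ?thesis using i1 lt_irrefl by metis
      qed
    qed
    then obtain g where g: "\<And>i. i \<in> C a \<Longrightarrow> g i \<in> K"
      "\<And>i b. i \<in> C a \<Longrightarrow> b \<in> past e a i \<Longrightarrow> lt (level l (g i)) (f b (g i)) (f (x i) (g i))"
      "\<And>i j. i \<in> C a \<Longrightarrow> j \<in> C a \<Longrightarrow> lt c i j \<Longrightarrow>
        lt (level l (g i)) (f (x i) (g i)) (f (e (nx i)) (g i))"
      by metis
    have "g ` C a \<subseteq> K" using g(1) by blast
    from large_fibre[OF k(1,2) nk K(3) a(3) this]
    obtain n where n: "n \<in> K" "k \<le>o |{i \<in> C a. g i = n}|" by blast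
    let ?D = "{i \<in> C a. g i = n}"
    have inc: "lt (level l n) (f (x i) n) (f (x j) n)" if i: "i \<in> ?D" and j: "j \<in> ?D" and ij: "lt c i j" for i j
    proof (rule lt_trans[OF wl[OF n(1)]])
      show "lt (level l n) (f (x i) n) (f (e (nx i)) n)" using g(3)[of i j] i j ij by simp
      have nxi: "nx i \<in> C a" "\<not> lt c j (nx i)" using nx[of i] i j ij by blast+
      then have "nx i = j \<or> lt c (nx i) j" using lt_linear[OF wc, of j "nx i"] a(2) j by blast
      then have "e (nx i) \<in> past e a j" using nxi(1) unfolding past_def by blast
      then show "lt (level l n) (f (e (nx i)) n) (f (x j) n)" using g(2)[of j] j by simp
    qed
    have "inj_on (\<lambda>i. f (x i) n) ?D"
    proof (rule inj_onI, rule ccontr)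
      fix i j assume ij: "i \<in> ?D" "j \<in> ?D" "f (x i) n = f (x j) n" "i \<noteq> j"
      then have "lt c i j \<or> lt c j i" using lt_linear[OF wc, of i j] a(2) by blast
      then show False using inc[OF ij(1,2)] inc[OF ij(2,1)] ij(3) by auto
    qed
    moreover have "(\<lambda>i. f (x i) n) ` ?D \<subseteq> (\<lambda>x. f x n) ` X" using x unfolding R_def by blast
    ultimately have "|?D| \<le>o |(\<lambda>x. f x n) ` X|" using card_of_ordLeq by blast
    then show ?thesis using n ordLeq_transitive by blast
  qed
  show thesis by (rule that[OF f1 spread])
qed

section \<open>From \<open>P_card k l\<close> to a cardinal\<close>

lemma mem_above_iff:
  assumes "Well_order m" "b \<in> Field m" "x \<in> Field m"
  shows "x \<in> above m b \<longleftrightarrow> \<not> lt m x b"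
  using le_iff_not_lt[OF assms] unfolding above_def by simp

text \<open>Pull the partition of \<open>above m (s a)\<close> back to \<open>P_card k l\<close> along \<open>s\<close>. A witness \<open>c\<close> for \<open>a\<close> and \<open>b\<close>
  includes both, so \<open>s c\<close> lies above \<open>s a\<close> and \<open>s b\<close> and belongs to both of the selected pieces.\<close>

lemma PS_plus2_if_monotone_unbounded:
  fixes s :: "'a set \<Rightarrow> 'm"
  assumes m: "Well_order m"
    and s: "\<And>a. a \<in> P_card k l \<Longrightarrow> s a \<in> Field m"
    and mono: "\<And>a c. a \<in> P_card k l \<Longrightarrow> c \<in> P_card k l \<Longrightarrow> a \<subseteq> c \<Longrightarrow> \<not> lt m (s c) (s a)"
    and unb: "\<And>b. b \<in> Field m \<Longrightarrow> \<exists>a\<in>P_card k l. lt m b (s a)"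
    and PS: "PS_plus3 t k l"
  shows "PS_plus2 t m"
  unfolding PS_plus2_def
proof (intro allI impI)
  fix Q assume Q: "\<forall>b\<in>Field m. partition_on (above m b) (Q b) \<and> |Q b| <o t"
  let ?P = "P_card k l"
  (* The sets c with s c below s a are sent to s a, that is, put into the piece that contains s a.
     No witness is of this kind. *)
  define mx where "mx a c = (if lt m (s c) (s a) then s a else s c)" for a c
  define pull where "pull a p = {c \<in> ?P. mx a c \<in> p}" for a p
  define Q' where "Q' a = pull a ` Q (s a) - {{}}" for a
  have mx: "mx a c \<in> above m (s a)" if "a \<in> ?P" "c \<in> ?P" for a c
    using mem_above_iff[OF m] s that unfolding mx_def by simp
  have part: "\<Union>(Q (s a)) = above m (s a)" "disjoint (Q (s a))" "|Q (s a)| <o t" if "a \<in> ?P" for a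
    using Q s[OF that] unfolding partition_on_def by auto
  have "partition_on ?P (Q' a) \<and> |Q' a| <o t" if a: "a \<in> ?P" for a
  proof
    show "partition_on ?P (Q' a)"
    proof (rule partition_onI)
      have "\<exists>p\<in>Q (s a). mx a c \<in> p" if "c \<in> ?P" for c
        using mx[OF a that] part(1)[OF a] by blast
      then show "\<Union>(Q' a) = ?P" unfolding Q'_def pull_def by blast
      show "disjnt p q" if "p \<in> Q' a" "q \<in> Q' a" "p \<noteq> q" for p q
        using that part(2)[OF a] unfolding Q'_def pull_def disjnt_def disjoint_def by blast
      show "{} \<notin> Q' a" unfolding Q'_def by blast
    qed
    have "|Q' a| \<le>o |pull a ` Q (s a)|" unfolding Q'_def by (rule card_of_mono1) blast
    also have "|pull a ` Q (s a)| \<le>o |Q (s a)|" by (rule card_of_image)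
    finally show "|Q' a| <o t" using part(3)[OF a] ordLeq_ordLess_trans by blast
  qed
  then have "\<forall>a\<in>?P. partition_on ?P (Q' a) \<and> |Q' a| <o t" ..
  from PS[unfolded PS_plus3_def, THEN spec, THEN mp, OF this]
  obtain B h where B: "B \<in> I_plus k l" and h: "h \<in> Pi\<^sub>E ?P Q'"
    and hB: "\<forall>a\<in>B. \<forall>b\<in>B. {c \<in> h a \<inter> h b. a \<union> b \<subseteq> c} \<noteq> {}"
    by (elim bexE)
  have BP: "B \<subseteq> ?P" using B unfolding I_plus_def by blast
  have "\<exists>p. p \<in> Q (s a) \<and> h a = pull a p" if "a \<in> ?P" for a
    using PiE_mem[OF h that] unfolding Q'_def by blast
  then obtain p where p: "\<And>a. a \<in> ?P \<Longrightarrow> p a \<in> Q (s a) \<and> h a = pull a (p a)" by metis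
  have "\<exists>a. a \<in> B \<and> s a = b" if "b \<in> s ` B" for b using that by blast
  then obtain r where r: "\<And>b. b \<in> s ` B \<Longrightarrow> r b \<in> B \<and> s (r b) = b" by metis
  show "\<exists>B. B \<subseteq> Field m \<and> cofinal B m \<and> (\<exists>h\<in>Pi\<^sub>E B Q. \<forall>\<alpha>\<in>B. \<forall>\<beta>\<in>B. h \<alpha> \<inter> h \<beta> \<noteq> {})"
  proof (intro exI[of _ "s ` B"] conjI bexI[of _ "restrict (p \<circ> r) (s ` B)"] ballI)
    show "s ` B \<subseteq> Field m" using s BP by blast
    show "cofinal (s ` B) m"
      unfolding cofinal_def
    proof
      fix b assume "b \<in> Field m"
      then obtain a where a: "a \<in> ?P" "lt m b (s a)" using unb by blast
      obtain c where c: "c \<in> B" "a \<subseteq> c" using B a(1) unfolding I_plus_def by blast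
      have "lt m b (s c)"
        using lt_not_lt_trans[OF m a(2) mono[OF a(1) _ c(2)] s] c(1) BP by blast
      then show "\<exists>c\<in>s ` B. b \<noteq> c \<and> (b, c) \<in> m" using c(1) unfolding underS_def by blast
    qed
    show "restrict (p \<circ> r) (s ` B) \<in> Pi\<^sub>E (s ` B) Q"
    proof
      fix b assume b: "b \<in> s ` B"
      show "restrict (p \<circ> r) (s ` B) b \<in> Q b" using p[of "r b"] r[OF b] BP b by auto
    qed simp
    fix x y assume x: "x \<in> s ` B" and y: "y \<in> s ` B"
    have rB: "r x \<in> B" "r y \<in> B" using r[OF x] r[OF y] by auto
    obtain c where c: "c \<in> h (r x)" "c \<in> h (r y)" "r x \<subseteq> c" "r y \<subseteq> c"
      using bspec[OF bspec[OF hB rB(1)] rB(2)] by auto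
    have P: "r x \<in> ?P" "r y \<in> ?P" using rB BP by auto
    have cP: "c \<in> ?P" using c(1) p[OF P(1)] unfolding pull_def by blast
    have "s c \<in> p (r x)"
      using c(1) p[OF P(1)] mono[OF P(1) cP c(3)] unfolding pull_def mx_def by simp
    moreover have "s c \<in> p (r y)"
      using c(2) p[OF P(2)] mono[OF P(2) cP c(4)] unfolding pull_def mx_def by simp
    ultimately show "restrict (p \<circ> r) (s ` B) x \<inter> restrict (p \<circ> r) (s ` B) y \<noteq> {}"
      using x y by auto
  qed
qed

text \<open>In the language of directed orders, \<open>d\<close> is a Tukey map: it sends unbounded subsets of \<open>m\<close> to
  unbounded subsets of \<open>P_card k l\<close>. The least strict upper bound of those \<open>g\<close> with \<open>d g \<subseteq> c\<close> is then
  a monotone unbounded function of \<open>c\<close>.\<close>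

lemma PS_plus2_if_Tukey_map:
  fixes d :: "'m \<Rightarrow> 'a set"
  assumes m: "Well_order m"
    and d: "\<And>g. g \<in> Field m \<Longrightarrow> d g \<in> P_card k l"
    and bd: "\<And>c. c \<in> P_card k l \<Longrightarrow> \<exists>b\<in>Field m. \<forall>g\<in>Field m. d g \<subseteq> c \<longrightarrow> lt m g b"
    and PS: "PS_plus3 t k l"
  shows "PS_plus2 t m"
proof -
  define ub where "ub c b \<longleftrightarrow> b \<in> Field m \<and> (\<forall>g\<in>Field m. d g \<subseteq> c \<longrightarrow> lt m g b)" for c b
  define s where "s c = (SOME b. ub c b \<and> (\<forall>z. lt m z b \<longrightarrow> \<not> ub c z))" for c
  have s: "ub c (s c)" "\<And>z. lt m z (s c) \<Longrightarrow> \<not> ub c z" if c: "c \<in> P_card k l" for c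
  proof -
    obtain b where "ub c b" using bd[OF c] unfolding ub_def by blast
    from someI_ex[OF exists_lt_least[OF m, of "ub c", OF this]]
    have "ub c (s c) \<and> (\<forall>z. lt m z (s c) \<longrightarrow> \<not> ub c z)" unfolding s_def .
    then show "ub c (s c)" "\<And>z. lt m z (s c) \<Longrightarrow> \<not> ub c z" by blast+
  qed
  show ?thesis
  proof (rule PS_plus2_if_monotone_unbounded[OF m _ _ _ PS])
    show "s a \<in> Field m" if "a \<in> P_card k l" for a using s(1)[OF that] unfolding ub_def by blast
    show "\<not> lt m (s c) (s a)" if "a \<in> P_card k l" "c \<in> P_card k l" "a \<subseteq> c" for a c
    proof
      assume "lt m (s c) (s a)"
      moreover have "ub a (s c)" using s(1)[OF that(2)] that(3) unfolding ub_def by blast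
      ultimately show False using s(2)[OF that(1)] by blast
    qed
    show "\<exists>a\<in>P_card k l. lt m b (s a)" if "b \<in> Field m" for b
      using s(1)[OF d[OF that]] d[OF that] that unfolding ub_def by blast
  qed
qed

text \<open>Singletons form a Tukey map, since a subset of \<open>l\<close> of size less than \<open>k\<close> is bounded.\<close>

lemma regular_case:
  assumes k: "natLeq <o k" and l: "Card_order l" "regularCard l" "k \<le>o l" and PS: "PS_plus3 t k l"
  shows "PS_plus2 t l"
proof (rule PS_plus2_if_Tukey_map[OF Card_order_Well_order[OF l(1)] _ _ PS])
  have "natLeq \<le>o l" using ordLess_ordLeq_trans[OF k l(3)] ordLess_imp_ordLeq by blast
  then have dir: "directed l (Field l) k"
    using Field_directed[OF l(1,2) infinite_Field_if_natLeq[OF l(1)] l(3)] by blast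
  show "{g} \<in> P_card k l" if "g \<in> Field l" for g
    using that k unfolding P_card_def
    by (simp, meson finite.emptyI finite_insert finite_iff_ordLess_natLeq ordLess_transitive)
  show "\<exists>b\<in>Field l. \<forall>g\<in>Field l. {g} \<subseteq> c \<longrightarrow> lt l g b" if c: "c \<in> P_card k l" for c
  proof -
    have "c \<subseteq> Field l" "|c| <o k" using c unfolding P_card_def by auto
    then have "\<exists>b\<in>Field l. \<forall>x\<in>c. lt l x b" using dir unfolding directed_def by blast
    then show ?thesis by auto
  qed
qed

lemma infinite_regular_not_ordIso_if_cf_less:
  assumes l: "Card_order l" "natLeq \<le>o l" and r: "Card_order r" "regularCard r" "natLeq \<le>o r"
    and cf: "cf l <o l"
  shows "\<not> r =o l"
proof
  assume rl: "r =o l"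
  have "Cinfinite r"
    using infinite_Field_if_natLeq[OF r(1,3)] r(1) unfolding cinfinite_def by blast
  then have "regularCard l" using regularCard_ordIso[OF rl _ r(2)] by blast
  then have "cf l =o l"
    using cf_least(1)[OF l] unfolding cofinal_cards_def regularCard_def by auto
  then show False using cf not_ordLess_ordIso by blast
qed

text \<open>The map \<open>d g\<close> codes the graph of \<open>f g\<close>, for the functions of \<open>spread_family\<close>, as a subset of \<open>l\<close> of
  size at most \<open>cf l\<close>. A set that includes cofinally many of these graphs has at least \<open>k\<close> elements.
  As \<open>l\<close> is singular, it differs from the regular cardinals \<open>k\<close>, \<open>cardSuc k\<close> and
  \<open>cardSuc (cardSuc k)\<close>; climbing along them, one finds all three below \<open>l\<close>.\<close>

lemma singular_case:
  fixes k :: "'k rel" and l :: "'a rel"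
  assumes k: "Card_order k" "regularCard k" "natLeq <o k"
    and l: "Card_order l" "k \<le>o l" and cf: "cf l <o k" and PS: "PS_plus3 t k l"
  shows "PS_plus2 t (cardSuc l)"
proof -
  have nk: "natLeq \<le>o k" using k(3) ordLess_imp_ordLeq by blast
  have nl: "natLeq \<le>o l" using nk l(2) ordLeq_transitive by blast
  have wl: "Well_order l" using l(1) Card_order_Well_order by blast
  have infl: "\<not> finite (Field l)" using infinite_Field_if_natLeq[OF l(1) nl] .
  have cfl: "cf l <o l" using ordLess_ordLeq_trans[OF cf l(2)] .
  define k1 where "k1 = cardSuc k"
  define c where "c = cardSuc k1"
  define m where "m = cardSuc l"
  have k1: "Card_order k1" "regularCard k1" "natLeq \<le>o k1" "k <o k1"
    unfolding k1_def using cardSuc_Card_order[OF k(1)] cardSuc_greater[OF k(1)]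
      infinite_cardSuc_regularCard[OF infinite_Field_if_natLeq[OF k(1) nk] k(1)]
      ordLeq_ordLess_trans[OF nk cardSuc_greater[OF k(1)]] ordLess_imp_ordLeq by auto
  have c: "Card_order c" "regularCard c" "natLeq \<le>o c" "k1 <o c"
    unfolding c_def using cardSuc_Card_order[OF k1(1)] cardSuc_greater[OF k1(1)]
      infinite_cardSuc_regularCard[OF infinite_Field_if_natLeq[OF k1(1,3)] k1(1)]
      ordLeq_ordLess_trans[OF k1(3) cardSuc_greater[OF k1(1)]] ordLess_imp_ordLeq by auto
  have "k <o l" using infinite_regular_not_ordIso_if_cf_less[OF l(1) nl k(1,2) nk cfl] l(2)
      ordLeq_iff_ordLess_or_ordIso by blast
  then have "k1 \<le>o l" unfolding k1_def using cardSuc_least[OF k(1) l(1)] by blast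
  then have "k1 <o l" using infinite_regular_not_ordIso_if_cf_less[OF l(1) nl k1(1-3) cfl]
      ordLeq_iff_ordLess_or_ordIso by blast
  then have "c \<le>o l" unfolding c_def using cardSuc_least[OF k1(1) l(1)] by blast
  then have cl: "c <o l" using infinite_regular_not_ordIso_if_cf_less[OF l(1) nl c(1-3) cfl]
      ordLeq_iff_ordLess_or_ordIso by blast
  have m: "Card_order m" "regularCard m" "c <o m"
    unfolding m_def using cardSuc_Card_order[OF l(1)] infinite_cardSuc_regularCard[OF infl l(1)]
      ordLess_transitive[OF cl cardSuc_greater[OF l(1)]] by auto
  have wm: "Well_order m" using m(1) Card_order_Well_order by blast
  have seg: "|underS m g| \<le>o l" if "g \<in> Field m" for g
    using card_of_underS[OF m(1) that] cardSuc_ordLeq_ordLess[OF l(1) card_of_Card_order]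
    unfolding m_def by blast
  obtain A where A: "A \<subseteq> Field l" "cofinal A l" "cf l = |A|"
    using cf_least(1)[OF l(1) nl] unfolding cofinal_cards_def by auto
  (* Beyond n0 the elements of l have at least c predecessors, as spread_family requires. *)
  obtain n0 where n0: "n0 \<in> Field l" "c =o Restr l (underS l n0)"
    using cl ordLess_iff_ordIso_Restr[OF wl Card_order_Well_order[OF c(1)]] by blast
  have "c \<le>o |underS l n0|"
  proof -
    have "c =o |Field c|" using card_of_Field_ordIso[OF c(1)] ordIso_symmetric by blast
    also have "|Field c| \<le>o |Field (Restr l (underS l n0))|"
      using card_of_mono2[OF ordIso_imp_ordLeq[OF n0(2)]] .
    also have "|Field (Restr l (underS l n0))| \<le>o |underS l n0|"
      by (rule card_of_mono1[OF Field_Restr_subset])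
    finally show ?thesis .
  qed
  moreover define K where "K = {n \<in> A. \<not> lt l n n0}"
  ultimately have big: "c \<le>o |underS l n|" if "n \<in> K" for n
  proof -
    have "underS l n0 \<subseteq> underS l n"
      using lt_not_lt_trans[OF wl, of _ n0 n] that A(1) unfolding K_def by blast
    then show ?thesis using \<open>c \<le>o |underS l n0|\<close> card_of_mono1 ordLeq_transitive by blast
  qed
  have KF: "K \<subseteq> Field l" using A(1) unfolding K_def by blast
  have Kcof: "\<exists>n\<in>K. lt l x n" if x: "x \<in> Field l" for x
  proof -
    have Ax: "\<exists>n\<in>A. lt l x n" if "x \<in> Field l" for x
      using A(2) that unfolding cofinal_def underS_def by blast
    show ?thesis
    proof (cases "lt l x n0")
      case True
      obtain n where "n \<in> A" "lt l n0 n" using Ax[OF n0(1)] by blast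
      then show ?thesis using lt_trans[OF wl True, of n] lt_trans[OF wl, of n0 n n0] unfolding K_def by auto
    next
      case False
      obtain n where n: "n \<in> A" "lt l x n" using Ax[OF x] by blast
      then show ?thesis using False lt_trans[OF wl, of x n n0] unfolding K_def by blast
    qed
  qed
  have Kk: "|K| <o k"
  proof -
    have "|K| \<le>o |A|" unfolding K_def by (rule card_of_mono1) blast
    then show ?thesis using cf A(3) ordLeq_ordLess_trans by metis
  qed
  have Kne: "K \<noteq> {}" using Kcof[OF n0(1)] by blast
  obtain f :: "'a set \<Rightarrow> 'a \<Rightarrow> 'a set" where
    f1: "\<And>g n. g \<in> Field m \<Longrightarrow> n \<in> K \<Longrightarrow> f g n \<in> Field (level l n)" and
    f2: "\<And>X. X \<subseteq> Field m \<Longrightarrow> cofinal X m \<Longrightarrow> \<exists>n\<in>K. k \<le>o |(\<lambda>x. f x n) ` X|"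
    using spread_family[OF k c(1,2) c(4)[unfolded k1_def] wl m seg KF Kcof Kk Kne big] by blast
  have "|SIGMA n : K. Field (level l n)| \<le>o l"
  proof (rule card_of_Sigma_ordLeq_infinite_Field[OF infl l(1)])
    show "|K| \<le>o l" using Kk l(2) ordLess_ordLeq_trans ordLess_imp_ordLeq by blast
    show "\<forall>n\<in>K. |Field (level l n)| \<le>o l"
    proof
      fix n assume "n \<in> K"
      then have "level l n \<le>o l"
        using cardSuc_least[OF card_of_Card_order l(1) card_of_underS[OF l(1)]] KF by blast
      then show "|Field (level l n)| \<le>o l"
        using card_of_Field_ordIso[OF cardSuc_Card_order[OF card_of_Card_order]] ordIso_ordLeq_trans
        by blast
    qed
  qed
  from card_of_mono2[OF this]
  have "|SIGMA n : K. Field (level l n)| \<le>o |Field l|" unfolding Field_card_of .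
  from card_of_ordLeq[THEN iffD2, OF this] obtain code where code: "inj_on code (SIGMA n : K. Field (level l n))"
    "code ` (SIGMA n : K. Field (level l n)) \<subseteq> Field l"
    by (elim exE conjE)
  define d where "d g = (\<lambda>n. code (n, f g n)) ` K" for g
  show ?thesis
    unfolding m_def[symmetric]
  proof (rule PS_plus2_if_Tukey_map[OF wm _ _ PS])
    show "d g \<in> P_card k l" if "g \<in> Field m" for g
    proof -
      have "d g \<subseteq> Field l" using code(2) f1[OF that] unfolding d_def by blast
      moreover have "|d g| <o k" unfolding d_def using card_of_image Kk ordLeq_ordLess_trans by blast
      ultimately show ?thesis unfolding P_card_def by blast
    qed
    fix a assume a: "a \<in> P_card k l"
    define X where "X = {g \<in> Field m. d g \<subseteq> a}"
    have "\<not> cofinal X m"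
    proof
      assume "cofinal X m"
      then obtain n where n: "n \<in> K" "k \<le>o |(\<lambda>x. f x n) ` X|" using f2[of X] unfolding X_def by blast
      have "inj_on (\<lambda>v. code (n, v)) ((\<lambda>x. f x n) ` X)"
        using code(1) f1 n(1) unfolding inj_on_def X_def by blast
      moreover have "(\<lambda>v. code (n, v)) ` ((\<lambda>x. f x n) ` X) \<subseteq> a"
        using n(1) unfolding X_def d_def by blast
      ultimately have "|(\<lambda>x. f x n) ` X| \<le>o |a|" using card_of_ordLeq by blast
      then have "k \<le>o |a|" using n(2) ordLeq_transitive by blast
      then show False using a not_ordLess_ordLeq unfolding P_card_def by blast
    qed
    then obtain b where b: "b \<in> Field m" "\<forall>x\<in>X. \<not> lt m b x"
      unfolding cofinal_def underS_def by blast
    have "natLeq \<le>o m" using ordLeq_transitive[OF c(3)] m(3) ordLess_imp_ordLeq by blast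
    from Card_order_nomax[OF m(1) this b(1)] obtain b' where b': "lt m b b'" by blast
    have "lt m g b'" if "g \<in> Field m" "d g \<subseteq> a" for g
      using not_lt_lt_trans[OF wm _ b' that(1)] b(2) that unfolding X_def by blast
    then show "\<exists>b\<in>Field m. \<forall>g\<in>Field m. d g \<subseteq> a \<longrightarrow> lt m g b" using lt_in_Field(2)[OF b'] by blast
  qed
qed

theorem proposition3p5:
  fixes k :: "'k rel" and l :: "'a rel" and t :: "'t rel"
  assumes "Card_order k" and "regularCard k" and "natLeq <o k"
    and "Card_order l" and "k \<le>o l"
    and "Card_order t" and "natLeq \<le>o t" and "t \<le>o k"
  shows "(regularCard l \<and> PS_plus3 t k l \<longrightarrow> PS_plus2 t l) \<and>
    (cf l <o k \<and> PS_plus3 (cardSuc (cf l)) k l \<longrightarrow>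
      PS_plus2 (cardSuc (cf l)) (cardSuc l))"
  using regular_case[OF assms(3,4) _ assms(5)] singular_case[OF assms(1-5)] by blast

end
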